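(* Let $n>k$ be positive integers and let $U$ be a unit interval order with $n+k$ elements. Then $$\#P^U_n\cdot\#P^U_k\ \ge\ \#P^U_{n+k}.$$
   Context: A unit interval order (UIO) $U$ is a finite subset of $\mathbb{R}$. For $a,b\in U$: $a\prec b$ (equivalently $b\succ a$) means $b\ge a+1$; $a\rightarrow b$ means $b>a-1$ (i.e. $a\succ b$ fails). A sequence $[w_1,\dots,w_m]$ of pairwise distinct elements of $U$ is an $m$-Escher if $w_1\rightarrow w_2\rightarrow\cdots\rightarrow w_m\rightarrow w_1$. $P^U_m$ denotes the set of $m$-Eschers in $U$. *)

theory Defs
  imports Complex_Main
begin

text \<open>A unit interval order is given by a finite subset of the reals. Its order relation,
  $a \prec b$ iff $b \geq a + 1$, is determined by the set.\<close>

definition unit_interval_order :: "real set \<Rightarrow> bool" where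
  "unit_interval_order U \<longleftrightarrow> finite U"

text \<open>$a \rightarrow b$, that is, $a \succ b$ fails.\<close>

definition arrow :: "real \<Rightarrow> real \<Rightarrow> bool" where
  "arrow a b \<longleftrightarrow> b > a - 1"

text \<open>Eschers are sequences, so cyclic rotations of an Escher are counted separately.
  The index \<open>Suc i mod m\<close> includes the closing relation from the last entry to the first.\<close>

definition eschers :: "real set \<Rightarrow> nat \<Rightarrow> real list set" where
  "eschers U m = {w. length w = m \<and> distinct w \<and> set w \<subseteq> U \<and>
                     (\<forall>i<m. arrow (w ! i) (w ! (Suc i mod m)))}"

end

theory Submission
  imports Defs
begin

text \<open>View an Escher \<open>w\<close> of length \<open>n + k\<close> as a periodic function on the integers. Cutting \<open>w\<close>
  before positions \<open>i + 1\<close> and \<open>i + k + 1\<close> yields two Eschers iff \<open>w (i + k) \<rightarrow> w (i + 1)\<close> and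
  \<open>w i \<rightarrow> w (i + k + 1)\<close>; call \<open>i\<close> bad if one of these fails. At most one fails, and consecutive
  bad positions fail in the same way, which makes \<open>w\<close> strictly monotone along steps of length \<open>k\<close>.
  By periodicity not all positions are bad, so there is a least good \<open>d \<ge> 0\<close>. Cut there, and extend
  the two pieces periodically without shifting the indices. The two extensions determine \<open>w\<close>
  once \<open>d\<close> is known, and the monotonicity shows that they cannot be glued back together at any
  position in \<open>{0..<d}\<close>. Hence they determine \<open>d\<close> as well.\<close>

section \<open>Eschers as periodic functions on the integers\<close>

text \<open>The equivalence encodes at once the period \<open>m\<close> and the distinctness of the
  \<open>m\<close> values in one period.\<close>

definition periodic_eschers :: "real set \<Rightarrow> int \<Rightarrow> (int \<Rightarrow> real) set" where
  "periodic_eschers U m = {f. range f \<subseteq> U \<and> (\<forall>s t. f s = f t \<longleftrightarrow> s mod m = t mod m) \<and>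
                              (\<forall>t. arrow (f t) (f (t + 1)))}"

lemma periodic_eschersD:
  assumes "f \<in> periodic_eschers U m"
  shows "f t \<in> U" "f s = f t \<longleftrightarrow> s mod m = t mod m" "arrow (f t) (f (t + 1))"
  using assms by (auto simp: periodic_eschers_def)

text \<open>The values at \<open>0, ..., m - 1\<close> give the list back; as the origin is fixed,
  rotations of a list stay different functions.\<close>

lemma bij_betw_eschers_periodic:
  assumes "0 < m"
  shows "bij_betw (\<lambda>w t. w ! nat (t mod int m)) (eschers U m) (periodic_eschers U (int m))"
proof (rule bij_betw_byWitness[where f' = "\<lambda>f. map (\<lambda>i. f (int i)) [0..<m]"])
  have lt: "nat (t mod int m) < m" for t
    using assms by (simp add: nat_less_iff)
  show "\<forall>w\<in>eschers U m. map (\<lambda>i. w ! nat (int i mod int m)) [0..<m] = w"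
    by (auto simp: eschers_def intro!: nth_equalityI)
  show "\<forall>f\<in>periodic_eschers U (int m).
      (\<lambda>t. map (\<lambda>i. f (int i)) [0..<m] ! nat (t mod int m)) = f"
  proof (intro ballI ext)
    fix f t assume "f \<in> periodic_eschers U (int m)"
    then have "f (t mod int m) = f t"
      by (simp add: periodic_eschersD(2))
    then show "map (\<lambda>i. f (int i)) [0..<m] ! nat (t mod int m) = f t"
      using lt[of t] assms by simp
  qed
  show "(\<lambda>w t. w ! nat (t mod int m)) ` eschers U m \<subseteq> periodic_eschers U (int m)"
  proof safe
    fix w assume w: "w \<in> eschers U m"
    have "arrow (w ! nat (t mod int m)) (w ! nat ((t + 1) mod int m))" for t
    proof -
      have "int (Suc (nat (t mod int m)) mod m) = (t + 1) mod int m"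
        using assms by (simp add: zmod_int mod_simps add.commute)
      then have "nat ((t + 1) mod int m) = Suc (nat (t mod int m)) mod m"
        by linarith
      then show ?thesis
        using w lt[of t] by (auto simp: eschers_def)
    qed
    moreover have "w ! nat (s mod int m) = w ! nat (t mod int m) \<longleftrightarrow> s mod int m = t mod int m" for s t
    proof -
      have "w ! nat (s mod int m) = w ! nat (t mod int m) \<longleftrightarrow> nat (s mod int m) = nat (t mod int m)"
        using w lt[of s] lt[of t] by (auto simp: eschers_def nth_eq_iff_index_eq)
      then show ?thesis
        using assms by (simp add: eq_nat_nat_iff)
    qed
    moreover have "w ! nat (t mod int m) \<in> U" for t
      using w lt[of t] by (auto simp: eschers_def)
    ultimately show "(\<lambda>t. w ! nat (t mod int m)) \<in> periodic_eschers U (int m)"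
      by (auto simp: periodic_eschers_def)
  qed
  show "(\<lambda>f. map (\<lambda>i. f (int i)) [0..<m]) ` periodic_eschers U (int m) \<subseteq> eschers U m"
  proof safe
    fix f assume f: "f \<in> periodic_eschers U (int m)"
    have "inj_on (\<lambda>i. f (int i)) {0..<m}"
      by (auto simp: inj_on_def periodic_eschersD(2)[OF f])
    moreover have "arrow (f (int i)) (f (int (Suc i mod m)))" for i
    proof -
      have "f (int (Suc i mod m)) = f (int i + 1)"
        by (simp add: periodic_eschersD(2)[OF f] zmod_int add.commute)
      then show ?thesis
        using periodic_eschersD(3)[OF f, of "int i"] by simp
    qed
    ultimately show "map (\<lambda>i. f (int i)) [0..<m] \<in> eschers U m"
      using assms periodic_eschersD(1)[OF f] by (auto simp: eschers_def distinct_map)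
  qed
qed

section \<open>Periodic extension of a window\<close>

text \<open>For \<open>m > 0\<close>, the \<open>m\<close>-periodic function that agrees with
  \<open>w\<close> on \<open>{c..<c + m}\<close>. Indices are not moved to start at 0, so extensions
  of different windows can be compared position by position.\<close>

definition extend_window :: "int \<Rightarrow> int \<Rightarrow> (int \<Rightarrow> real) \<Rightarrow> int \<Rightarrow> real" where
  "extend_window m c w t = w (c + (t - c) mod m)"

lemma extend_window_inside:
  "c \<le> t \<Longrightarrow> t < c + m \<Longrightarrow> extend_window m c w t = w t"
  by (simp add: extend_window_def)

lemma extend_window_add: "extend_window m c w (t + m) = extend_window m c w t"
  by (metis add_diff_eq diff_add_eq extend_window_def mod_add_self2)

text \<open>A window of length \<open>m \<le> N\<close> meets each residue modulo \<open>N\<close>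
  at most once, so its values are distinct. The only arrow not inherited from \<open>w\<close> is
  the one closing the window.\<close>

lemma extend_window_eschers:
  assumes w: "w \<in> periodic_eschers U N" and m: "0 < m" "m \<le> N"
    and closed: "arrow (w (c + m - 1)) (w c)"
  shows "extend_window m c w \<in> periodic_eschers U m"
proof -
  have "extend_window m c w s = extend_window m c w t \<longleftrightarrow> s mod m = t mod m" for s t
  proof -
    have r: "0 \<le> (s - c) mod m" "(s - c) mod m < m" "0 \<le> (t - c) mod m" "(t - c) mod m < m"
      using m by auto
    have "extend_window m c w s = extend_window m c w t \<longleftrightarrow> N dvd (s - c) mod m - (t - c) mod m"
      by (simp add: extend_window_def periodic_eschersD(2)[OF w] mod_eq_dvd_iff)
    also have "\<dots> \<longleftrightarrow> (s - c) mod m = (t - c) mod m"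
    proof
      assume "N dvd (s - c) mod m - (t - c) mod m"
      moreover have "\<bar>(s - c) mod m - (t - c) mod m\<bar> < N"
        using r m by linarith
      ultimately show "(s - c) mod m = (t - c) mod m"
        using dvd_imp_le_int[of "(s - c) mod m - (t - c) mod m" N] by fastforce
    qed simp
    also have "\<dots> \<longleftrightarrow> s mod m = t mod m"
      by (simp add: mod_eq_dvd_iff)
    finally show ?thesis .
  qed
  moreover have "arrow (extend_window m c w t) (extend_window m c w (t + 1))" for t
  proof -
    define r where "r = (t - c) mod m"
    have r: "0 \<le> r" "r < m"
      using m by (auto simp: r_def)
    have eq: "(t + 1 - c) mod m = (r + 1) mod m"
      by (simp add: r_def mod_add_left_eq diff_add_eq)
    show ?thesis
    proof (cases "r + 1 = m")
      case True
      then have "r = m - 1" "(r + 1) mod m = 0"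
        by auto
      then show ?thesis
        using closed by (simp add: extend_window_def eq add_diff_eq flip: r_def)
    next
      case False
      then have "(r + 1) mod m = r + 1"
        using r by simp
      then show ?thesis
        using periodic_eschersD(3)[OF w, of "c + r"]
        by (simp add: extend_window_def eq add.assoc flip: r_def)
    qed
  qed
  ultimately show ?thesis
    using periodic_eschersD(1)[OF w] by (auto simp: periodic_eschers_def extend_window_def)
qed

section \<open>Runs of bad cut positions\<close>

locale cut_escher =
  fixes w :: "int \<Rightarrow> real" and n k :: int
  assumes k_pos: "0 < k" and k_less: "k < n"
    and periodic: "w (t + (n + k)) = w t"
    and step: "w t < w (t + 1) + 1"
begin

definition good :: "int \<Rightarrow> bool" where
  "good i \<longleftrightarrow> arrow (w (i + k)) (w (i + 1)) \<and> arrow (w i) (w (i + k + 1))"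

lemma good_add_period: "good (i + (n + k)) \<longleftrightarrow> good i"
  using periodic[of i] periodic[of "i + k"] periodic[of "i + 1"] periodic[of "i + k + 1"]
  by (simp add: good_def algebra_simps)

text \<open>A change of kind between \<open>j\<close> and \<open>j + 1\<close> would make
  \<open>w\<close> drop by at least 2 in two steps, from \<open>j + k\<close> to
  \<open>j + k + 2\<close> or from \<open>j\<close> to \<open>j + 2\<close>, while a single step
  drops by less than 1.\<close>

lemma bad_run_cases:
  assumes bad: "\<And>j. 0 \<le> j \<Longrightarrow> j < d \<Longrightarrow> \<not> good j"
  shows "(\<forall>j. 0 \<le> j \<and> j < d \<longrightarrow> w (j + 1) + 1 \<le> w (j + k)) \<or>
         (\<forall>j. 0 \<le> j \<and> j < d \<longrightarrow> w (j + k + 1) + 1 \<le> w j)"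
proof -
  let ?A = "\<lambda>j. w (j + 1) + 1 \<le> w (j + k)" and ?B = "\<lambda>j. w (j + k + 1) + 1 \<le> w j"
  have AB: "?A j \<or> ?B j" if "0 \<le> j" "j < d" for j
    using bad[OF that] by (auto simp: good_def arrow_def)
  have "?A j \<longrightarrow> \<not> ?B (j + 1)" for j
    using step[of "j + k"] step[of "j + k + 1"] by (auto simp: algebra_simps)
  then have stepA: "?A (j + 1)" if "?A j" "0 \<le> j" "j + 1 < d" for j
    using that AB[of "j + 1"] by auto
  have "?B j \<longrightarrow> \<not> ?A (j + 1)" for j
    using step[of j] step[of "j + 1"] by (auto simp: algebra_simps)
  then have stepB: "?B (j + 1)" if "?B j" "0 \<le> j" "j + 1 < d" for j
    using that AB[of "j + 1"] by auto
  have *: "\<forall>j. 0 \<le> j \<and> j < d \<longrightarrow> P j"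
    if "P 0" "\<And>j. P j \<Longrightarrow> 0 \<le> j \<Longrightarrow> j + 1 < d \<Longrightarrow> P (j + 1)" for P :: "int \<Rightarrow> bool"
  proof safe
    fix j :: int assume "0 \<le> j" "j < d"
    then show "P j"
      by (induction rule: int_ge_induct) (use that in auto)
  qed
  show ?thesis
  proof (cases "0 < d")
    case True
    then have "?A 0 \<or> ?B 0"
      using AB by blast
    then show ?thesis
      using *[of ?A] *[of ?B] stepA stepB by blast
  qed auto
qed

text \<open>The position \<open>d\<close> ending the run need not be bad itself: the steps of \<open>w\<close> after \<open>d - 1\<close>
  still give the inequality there.\<close>

lemma increasing_if_bad:
  assumes "\<forall>j. 0 \<le> j \<and> j < d \<longrightarrow> w (j + 1) + 1 \<le> w (j + k)" and "0 < d" "0 \<le> j" "j \<le> d"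
  shows "w j < w (j + k)"
proof (cases "j < d")
  case True
  then show ?thesis
    using assms(1,3) step[of j] by (smt (verit))
next
  case False
  then have "w (j - 1 + 1) + 1 \<le> w (j - 1 + k)"
    using assms(1)[rule_format, of "j - 1"] assms(2-) by simp
  then show ?thesis
    using False assms(4) step[of "j - 1 + k"] by simp
qed

lemma decreasing_if_bad:
  assumes "\<forall>j. 0 \<le> j \<and> j < d \<longrightarrow> w (j + k + 1) + 1 \<le> w j" and "0 < d" "0 \<le> j" "j \<le> d"
  shows "w (j + k) < w j"
proof (cases "j < d")
  case True
  then show ?thesis
    using assms(1,3) step[of "j + k"] by (smt (verit))
next
  case False
  then have "w (j - 1 + k + 1) + 1 \<le> w (j - 1)"
    using assms(1)[rule_format, of "j - 1"] assms(2-) by simp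
  then show ?thesis
    using False assms(4) step[of "j - 1"] by simp
qed

lemma periodic_mult: "w (t + int c * (n + k)) = w t"
proof (induction c)
  case (Suc c)
  then show ?case
    using periodic[of "t + int c * (n + k)"] by (simp add: algebra_simps)
qed simp

text \<open>If all positions were bad, \<open>w 0, w k, w (2 * k), ...\<close> would be strictly
  monotone, yet this sequence returns to \<open>w 0\<close> after \<open>n + k\<close>
  jumps.\<close>

lemma ex_good: "\<exists>d::nat. good (int d)"
proof (rule ccontr)
  assume "\<not> ?thesis"
  then have bad: "\<not> good j" if "0 \<le> j" for j
    using that by (metis nat_0_le)
  define N where "N = nat (n + k)"
  have N: "int N = n + k" "0 < N"
    using k_pos k_less by (auto simp: N_def)
  \<comment> \<open>\<open>N\<close> jumps of length \<open>k\<close> amount to \<open>k\<close>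
    full periods.\<close>
  have cyc: "w (0 + int N * k) = w 0"
    using periodic_mult[of 0 "nat k"] k_pos N by (simp add: algebra_simps)
  have D: "0 < int N * k + 1"
    using k_pos by (smt (verit) mult_nonneg_nonneg of_nat_0_le_iff)
  have le: "0 \<le> int c * k" "int c * k \<le> int N * k + 1" if "c < N" for c
    using k_pos that by (auto intro: order_trans[OF mult_right_mono[of "int c" "int N"]])
  consider
      (A) "\<forall>j. 0 \<le> j \<and> j < int N * k + 1 \<longrightarrow> w (j + 1) + 1 \<le> w (j + k)"
    | (B) "\<forall>j. 0 \<le> j \<and> j < int N * k + 1 \<longrightarrow> w (j + k + 1) + 1 \<le> w j"
    using bad_run_cases[of "int N * k + 1"] bad by blast
  then show False
  proof cases
    case A
    have "w (int c * k) < w (int (Suc c) * k)" if "c < N" for c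
      using increasing_if_bad[OF A D le[OF that]] by (simp add: algebra_simps)
    then have "0 < (\<Sum>c<N. w (int (Suc c) * k) - w (int c * k))"
      using \<open>0 < N\<close> by (intro sum_pos) auto
    also have "\<dots> = w (int N * k) - w (int 0 * k)"
      by (rule sum_lessThan_telescope)
    finally show False
      using cyc by simp
  next
    case B
    have "w (int (Suc c) * k) < w (int c * k)" if "c < N" for c
      using decreasing_if_bad[OF B D le[OF that]] by (simp add: algebra_simps)
    then have "0 < (\<Sum>c<N. w (int c * k) - w (int (Suc c) * k))"
      using \<open>0 < N\<close> by (intro sum_pos) auto
    also have "\<dots> = w (int 0 * k) - w (int N * k)"
      by (rule sum_lessThan_telescope')
    finally show False
      using cyc by simp
  qed
qed

section \<open>The cut at the first good position\<close>

definition first_good :: int where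
  "first_good = int (LEAST d. good (int d))"

lemma good_first_good: "good first_good"
  unfolding first_good_def using ex_good by (rule LeastI_ex)

lemma bad_before_first_good:
  assumes "0 \<le> j" "j < first_good"
  shows "\<not> good j"
  using assms not_less_Least[of "nat j" "\<lambda>d. good (int d)"] by (auto simp: first_good_def)

lemma first_good_bounds: "0 \<le> first_good" "first_good < n + k"
proof -
  show "0 \<le> first_good"
    by (simp add: first_good_def)
  have "good (first_good - (n + k))"
    using good_first_good good_add_period[of "first_good - (n + k)"] by simp
  then show "first_good < n + k"
    using bad_before_first_good[of "first_good - (n + k)"] k_pos k_less by fastforce
qed

text \<open>The windows of \<open>short_part\<close> and \<open>long_part\<close> are adjacent and
  together fill one period, from \<open>first_good + 1 - n\<close> to \<open>first_good + k\<close>.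
  The long piece is thus taken one period before the place following the short one.\<close>

definition short_part :: "int \<Rightarrow> real" where
  "short_part = extend_window k (first_good + 1) w"

definition long_part :: "int \<Rightarrow> real" where
  "long_part = extend_window n (first_good + 1 - n) w"

lemma short_part_inside:
  "first_good < t \<Longrightarrow> t \<le> first_good + k \<Longrightarrow> short_part t = w t"
  by (simp add: short_part_def extend_window_inside)

lemma long_part_inside:
  "first_good - n < t \<Longrightarrow> t \<le> first_good \<Longrightarrow> long_part t = w t"
  by (simp add: long_part_def extend_window_inside)

lemma short_part_add: "short_part (t + k) = short_part t"
  by (simp add: short_part_def extend_window_add)

lemma long_part_add: "long_part (t + n) = long_part t"
  by (simp add: long_part_def extend_window_add)

text \<open>Serves to compare \<open>short_part\<close> with \<open>w\<close> to the left of its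
  window, which may be many jumps of length \<open>k\<close> away.\<close>

lemma short_part_induct [consumes 1, case_names window below]:
  assumes "t \<le> first_good + k"
    and "\<And>t. first_good < t \<Longrightarrow> t \<le> first_good + k \<Longrightarrow> P t"
    and "\<And>t. t \<le> first_good \<Longrightarrow> P (t + k) \<Longrightarrow> P t"
  shows "P t"
  using assms(1)
proof (induction "nat (first_good + k - t)" arbitrary: t rule: less_induct)
  case less
  show ?case
  proof (cases "first_good < t")
    case True
    then show ?thesis
      using assms(2) less.prems by blast
  next
    case False
    moreover from this have "P (t + k)"
      using k_pos by (intro less.hyps) auto
    ultimately show ?thesis
      using assms(3) by simp
  qed
qed

text \<open>Undoing the cut: the two arrows are the steps of \<open>w\<close> out of
  \<open>first_good\<close> and \<open>first_good + k\<close>.\<close>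

lemma glue_first_good:
  "arrow (long_part first_good) (short_part (first_good + 1))"
  "arrow (short_part first_good) (long_part (first_good + 1))"
proof -
  have "long_part first_good = w first_good" "short_part (first_good + 1) = w (first_good + 1)"
    using k_pos k_less by (auto simp: long_part_inside short_part_inside)
  then show "arrow (long_part first_good) (short_part (first_good + 1))"
    using step[of first_good] by (simp add: arrow_def)
  have "short_part first_good = w (first_good + k)"
    using k_pos short_part_add[of first_good] by (simp add: short_part_inside)
  moreover have "long_part (first_good + 1) = w (first_good + k + 1)"
    using k_pos k_less long_part_add[of "first_good + 1 - n"] periodic[of "first_good + 1 - n"]
    by (simp add: long_part_inside algebra_simps)
  ultimately show "arrow (short_part first_good) (long_part (first_good + 1))"
    using step[of "first_good + k"] by (simp add: arrow_def)
qed

text \<open>Monotonicity along jumps of \<open>k\<close> only widens the gap that makes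
  \<open>x\<close> bad. In case \<open>A\<close>, \<open>short_part x\<close> is at least
  \<open>w (x + k)\<close> and \<open>long_part (x + 1)\<close> at most \<open>w (x + 1)\<close>, so
  the second arrow fails; in case \<open>B\<close>, the first fails symmetrically.\<close>

lemma no_glue_before_first_good:
  assumes x: "0 \<le> x" "x < first_good"
  shows "\<not> (arrow (long_part x) (short_part (x + 1)) \<and> arrow (short_part x) (long_part (x + 1)))"
proof -
  consider
      (A) "\<forall>j. 0 \<le> j \<and> j < first_good \<longrightarrow> w (j + 1) + 1 \<le> w (j + k)"
    | (B) "\<forall>j. 0 \<le> j \<and> j < first_good \<longrightarrow> w (j + k + 1) + 1 \<le> w j"
    using bad_run_cases[of first_good] bad_before_first_good by blast
  then show ?thesis
  proof cases
    case A
    note inc = increasing_if_bad[OF A]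
    have "0 \<le> t \<longrightarrow> w t \<le> short_part t" if "t \<le> first_good + k" for t
      using that
    proof (induction t rule: short_part_induct)
      case (below t)
      then show ?case
        using inc[of t] x k_pos by (auto simp: short_part_add)
    qed (simp_all add: short_part_inside)
    from this[of "x + k"] have 1: "w (x + k) \<le> short_part x"
      using x k_pos by (simp add: short_part_add)
    have 2: "long_part (x + 1) \<le> w (x + 1)"
    proof (cases "first_good - n < x + 1")
      case True
      then show ?thesis
        using x by (simp add: long_part_inside)
    next
      case False
      \<comment> \<open>One shift by \<open>n\<close> reaches the window because
        \<open>first_good < n + k < 2 * n\<close>. A further jump by \<open>k\<close> completes a
        period and leads back to the value \<open>w (x + 1)\<close>.\<close>
      then have "long_part (x + 1) = w (x + 1 + n)"
        using x k_less first_good_bounds long_part_add[of "x + 1"] long_part_inside[of "x + 1 + n"]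
        by linarith
      then show ?thesis
        using inc[of "x + 1 + n"] periodic[of "x + 1"] x False k_less k_pos
        by (simp add: algebra_simps)
    qed
    show ?thesis
      using 1 2 A x by (force simp: arrow_def)
  next
    case B
    note dec = decreasing_if_bad[OF B]
    have "0 \<le> t \<longrightarrow> short_part t \<le> w t" if "t \<le> first_good + k" for t
      using that
    proof (induction t rule: short_part_induct)
      case (below t)
      then show ?case
        using dec[of t] x k_pos by (auto simp: short_part_add)
    qed (simp_all add: short_part_inside)
    from this[of "x + 1 + k"] have 1: "short_part (x + 1) \<le> w (x + k + 1)"
      using x k_pos short_part_add[of "x + 1"] by (simp add: algebra_simps)
    have 2: "w x \<le> long_part x"
    proof (cases "first_good - n < x")
      case True
      then show ?thesis
        using x by (simp add: long_part_inside)
    next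
      case False
      then have "long_part x = w (x + n)"
        using x k_less first_good_bounds long_part_add[of x] long_part_inside[of "x + n"]
        by linarith
      then show ?thesis
        using dec[of "x + n"] periodic[of x] x False k_less k_pos
        by (simp add: algebra_simps)
    qed
    show ?thesis
      using 1 2 B x by (force simp: arrow_def)
  qed
qed

end

section \<open>Injectivity of the cut and the count\<close>

lemma cut_escher_periodic:
  assumes "0 < k" "k < n" "w \<in> periodic_eschers U (n + k)"
  shows "cut_escher w n k"
proof
  show "w (t + (n + k)) = w t" for t
    using assms by (simp add: periodic_eschersD(2))
  show "w t < w (t + 1) + 1" for t
    using periodic_eschersD(3)[OF assms(3), of t] by (simp add: arrow_def)
qed (use assms in auto)

text \<open>The two arrows in \<open>good first_good\<close> are exactly the closing arrows of the
  pieces, the long one after a shift by one period.\<close>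

lemma parts_in_periodic_eschers:
  assumes "0 < k" "k < n" and w: "w \<in> periodic_eschers U (n + k)"
  shows "cut_escher.long_part w n k \<in> periodic_eschers U n"
    and "cut_escher.short_part w k \<in> periodic_eschers U k"
proof -
  interpret cut_escher w n k
    using assms by (rule cut_escher_periodic)
  have "w (first_good + 1 - n) = w (first_good + k + 1)"
    using periodic[of "first_good + 1 - n"] by (simp add: algebra_simps)
  then show "long_part \<in> periodic_eschers U n"
    unfolding long_part_def using good_first_good k_pos k_less
    by (intro extend_window_eschers[OF w]) (auto simp: good_def)
  show "short_part \<in> periodic_eschers U k"
    unfolding short_part_def using good_first_good k_pos k_less
    by (intro extend_window_eschers[OF w]) (auto simp: good_def algebra_simps)
qed

text \<open>The gluing condition involves only the pieces. If the two cut positions differed, the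
  smaller would admit gluing although it lies before the larger.\<close>

lemma parts_determine_escher:
  assumes "cut_escher w n k" "cut_escher w' n k"
    and L: "cut_escher.long_part w n k = cut_escher.long_part w' n k"
    and S: "cut_escher.short_part w k = cut_escher.short_part w' k"
  shows "w = w'"
proof
  fix t
  interpret a: cut_escher w n k by fact
  interpret b: cut_escher w' n k by fact
  have "\<not> a.first_good < b.first_good"
    using b.no_glue_before_first_good[of a.first_good] a.glue_first_good a.first_good_bounds L S
    by auto
  moreover have "\<not> b.first_good < a.first_good"
    using a.no_glue_before_first_good[of b.first_good] b.glue_first_good b.first_good_bounds L S
    by auto
  ultimately have d: "a.first_good = b.first_good"
    by simp
  define c where "c = a.first_good + 1 - n"
  \<comment> \<open>The representative of \<open>t\<close> in the period filled by the two windows,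
    where each value of \<open>w\<close> is read off one of the pieces.\<close>
  define s where "s = c + (t - c) mod (n + k)"
  have s: "c \<le> s" "s < c + (n + k)"
    using a.k_pos a.k_less by (auto simp: s_def)
  have "w s = w' s"
  proof (cases "s \<le> a.first_good")
    case True
    then show ?thesis
      using s d L a.long_part_inside[of s] b.long_part_inside[of s] by (simp add: c_def)
  next
    case False
    then show ?thesis
      using s d S a.short_part_inside[of s] b.short_part_inside[of s] by (simp add: c_def)
  qed
  moreover have "f s = f t" if "cut_escher f n k" for f
  proof -
    interpret f: cut_escher f n k by fact
    \<comment> \<open>\<open>periodic_mult\<close> covers natural multiples of the period; for a
      negative quotient the shift is made from \<open>t\<close> to \<open>s\<close> instead.\<close>
    have *: "f (u + q * (n + k)) = f u" if "0 \<le> q" for u q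
      using f.periodic_mult[of u "nat q"] that by simp
    have t: "t = s + ((t - c) div (n + k)) * (n + k)"
      unfolding s_def by (simp add: algebra_simps flip: minus_mult_div_eq_mod)
    show ?thesis
    proof (cases "0 \<le> (t - c) div (n + k)")
      case True
      then show ?thesis
        using * t by metis
    next
      case False
      have "s = t + (- ((t - c) div (n + k))) * (n + k)"
        using t by (simp only: minus_mult_left[symmetric])
      then show ?thesis
        using *[of "- ((t - c) div (n + k))" t] False by simp
    qed
  qed
  ultimately show "w t = w' t"
    using assms(1,2) by metis
qed

lemma finite_eschers: "finite U \<Longrightarrow> finite (eschers U m)"
  by (rule finite_subset[OF _ finite_lists_length_eq[of U m]]) (auto simp: eschers_def)

theorem theorem4p1:
  fixes U :: "real set" and n k :: nat
  assumes "0 < k" and "k < n"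
    and "unit_interval_order U"
    and "card U = n + k"
  shows "card (eschers U n) * card (eschers U k) \<ge> card (eschers U (n + k))"
proof -
  let ?P = "\<lambda>m. periodic_eschers U (int m)"
  have card: "card (eschers U m) = card (?P m)" and fin: "finite (?P m)" if "0 < m" for m
    using bij_betw_eschers_periodic[OF that, of U] finite_eschers[of U m] assms(3)
    by (auto simp: unit_interval_order_def dest: bij_betw_same_card bij_betw_finite)
  let ?parts = "\<lambda>w. (cut_escher.long_part w (int n) (int k), cut_escher.short_part w (int k))"
  have nk: "0 < int k" "int k < int n"
    using assms by auto
  have "inj_on ?parts (?P (n + k))"
  proof (rule inj_onI)
    fix w w' assume "w \<in> ?P (n + k)" "w' \<in> ?P (n + k)" and eq: "?parts w = ?parts w'"
    then have "cut_escher w (int n) (int k)" "cut_escher w' (int n) (int k)"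
      using cut_escher_periodic[OF nk] by auto
    then show "w = w'"
      using eq by (auto intro: parts_determine_escher)
  qed
  moreover have "?parts ` ?P (n + k) \<subseteq> ?P n \<times> ?P k"
    using parts_in_periodic_eschers[OF nk] by (auto simp: image_subset_iff)
  ultimately have "card (?P (n + k)) \<le> card (?P n \<times> ?P k)"
    using assms(1,2) fin by (intro card_inj_on_le[of ?parts]) auto
  then show ?thesis
    using assms(1,2) by (simp add: card card_cartesian_product)
qed

end
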